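(* Let $t\ge1$, $n\ge2$ be integers and let $p\ge9$ be odd. If $G\in \mathcal{GL}^4_t(p-n,n)\cup \mathcal{GL}^5_t(p-n,n) \cup \mathcal{GL}^6_t(p-n+1,n)$, then $\chi_{la}(G)=3$.
   Context: Local antimagic chromatic number: for a graph $G=(V,E)$ (possibly disconnected, with no $K_2$ component; parallel edges are permitted, each counted separately) a bijection $f:E\to\{1,\dots,|E|\}$ is a local antimagic labeling if $f^+(u)\ne f^+(v)$ for any two adjacent vertices $u,v$, where $f^+(u)$ is the sum of $f(e)$ over all edges $e$ incident to $u$. $\chi_{la}(G)$ is the minimum, over all local antimagic labelings $f$ of $G$, of the number of distinct values of $f^+$ on $V$. Luv graphs: let $p\ge 9$ be odd and $n\ge2$. A Luv graph with parameters $(p,n)$ is a simple graph on $p$ vertices $u_1,\dots,u_p$ whose edge set is $\bigcup_{\phi=1}^n (E^\phi\cup F^\phi)$, where: (1) $E^1=\{u_iu_{i+1}: 1\le i\le p-1\}$; (2) for $2\le\phi\le n$, $E^\phi=\{u_{j^\phi_i}u_{j^\phi_{i+1}}:1\le i\le p-1\}$, where $(j^\phi_1,\dots,j^\phi_p)$ is a permutation of $\{1,\dots,p\}$ with $j^\phi_1=1$, $j^\phi_p=p$ and $|j^\phi_{i+1}-j^\phi_i|$ odd and $\ge 3$ for all $1\le i\le p-1$; moreover $E^\phi\cap E^{\phi'}=\varnothing$ for $2\le\phi\ne\phi'\le n$; (3) $F^\phi=\{u_1u_{2a^\phi+1},\,u_pu_{2a^\phi+1}\}$ for $1\le\phi\le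 n$, where $a^1,\dots,a^n$ are pairwise distinct integers in $[1,\frac{p-3}{2}]$. In a Luv graph the vertex set splits into three independent classes: $S$, the $n$ vertices $u_{2a^\phi+1}$ of degree $2n+2$; $O$, the remaining $(p-2n+1)/2$ vertices with odd subscript (degree $2n$); and $Q$, the $(p-1)/2$ vertices with even subscript (degree $2n$). $\mathcal L_t(p,n)$ (also written $\mathcal{GL}_t(p,n)$) is the family of disjoint unions of $t$ Luv graphs with parameters $(p,n)$ (choices may differ between components). Merged families: merging vertices means identifying them to one vertex incident to all edges formerly incident to any of them (all edges are kept). (a) $\mathcal{GL}^4_t(p-n,n)$: graphs with $t\ge1$ components obtained from a graph in $\mathcal L_t(p,n)$ such that in every component there are $n$ distinct vertices $v_1,\dots,v_n$ of class $O$ none of which is adjacent to, or has a common neighbor with, any vertex of class $S$, by merging, in each component, the $n$ vertices of class $S$ bijectively with $v_1,\dots,v_n$. (b) $\mathcal{GL}^5_t(p-n,n)$: the same as (a) but with $v_1,\dots,v_n$ of class $Q$. (c) $\mathcal{GL}^6_t(p-n+1,n)$: graphs with $t\ge1$ components obtained from a graph in $\mathcal L_t(p,n)$ by merging, in each component, all the $n$ vertices of class $S$ into a single vertex, of degree $n(2n+2)$. In each case the first argument is the order of each component. *)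

theory Defs
  imports Complex_Main
begin

section \<open>Multigraphs and local antimagic labelings\<close>

text \<open>Undirected multigraphs: edges have an identity of their own, so parallel edges are distinct
  elements of \<open>edges\<close> with the same set of end vertices.  All graphs below are loopless, i.e.
  \<open>ends G e\<close> has exactly two elements for every edge \<open>e\<close>.\<close>

record ('v, 'e) multigraph =
  verts :: "'v set"
  edges :: "'e set"
  ends :: "'e \<Rightarrow> 'v set"

definition adjacent :: "('v, 'e) multigraph \<Rightarrow> 'v \<Rightarrow> 'v \<Rightarrow> bool" where
  "adjacent G u v \<longleftrightarrow> (\<exists>e\<in>edges G. ends G e = {u, v})"

definition vertex_sum :: "('v, 'e) multigraph \<Rightarrow> ('e \<Rightarrow> nat) \<Rightarrow> 'v \<Rightarrow> nat" where
  "vertex_sum G f u = (\<Sum>e | e \<in> edges G \<and> u \<in> ends G e. f e)"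

definition local_antimagic :: "('v, 'e) multigraph \<Rightarrow> ('e \<Rightarrow> nat) \<Rightarrow> bool" where
  "local_antimagic G f \<longleftrightarrow>
     bij_betw f (edges G) {1..card (edges G)} \<and>
     (\<forall>u\<in>verts G. \<forall>v\<in>verts G. adjacent G u v \<longrightarrow> vertex_sum G f u \<noteq> vertex_sum G f v)"

text \<open>The infimum is a minimum whenever \<open>G\<close> has a local antimagic labeling; otherwise it
  is \<open>Inf {} = 0\<close>.  So \<open>chi_la G = 3\<close> includes the existence of a labeling.\<close>

definition chi_la :: "('v, 'e) multigraph \<Rightarrow> nat" where
  "chi_la G = Inf {card (vertex_sum G f ` verts G) | f. local_antimagic G f}"

section \<open>Disjoint unions and merging of vertices\<close>

definition disjoint_union ::
    "'i set \<Rightarrow> ('i \<Rightarrow> ('v, 'e) multigraph) \<Rightarrow> ('i \<times> 'v, 'i \<times> 'e) multigraph" where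
  "disjoint_union I H =
     \<lparr> verts = Sigma I (\<lambda>c. verts (H c)),
       edges = Sigma I (\<lambda>c. edges (H c)),
       ends = (\<lambda>(c, e). Pair c ` ends (H c) e) \<rparr>"

text \<open>\<open>arises_by_merging H \<B> G\<close>: up to isomorphism, \<open>G\<close> is the graph obtained from \<open>H\<close> by
  identifying, for each block \<open>B \<in> \<B>\<close> (the blocks being pairwise disjoint), all the vertices in
  \<open>B\<close> to a single vertex, and keeping all edges.  Here \<open>h\<close> is the quotient map on vertices and
  \<open>g\<close> the identification of the edges.\<close>

definition arises_by_merging ::
    "('a, 'd) multigraph \<Rightarrow> 'a set set \<Rightarrow> ('v, 'e) multigraph \<Rightarrow> bool" where
  "arises_by_merging H \<B> G \<longleftrightarrow>
     (\<exists>h g. verts G = h ` verts H \<and>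
        (\<forall>x\<in>verts H. \<forall>y\<in>verts H. h x = h y \<longleftrightarrow> x = y \<or> (\<exists>B\<in>\<B>. x \<in> B \<and> y \<in> B)) \<and>
        bij_betw g (edges H) (edges G) \<and>
        (\<forall>e\<in>edges H. ends G (g e) = h ` ends H e))"

section \<open>Luv graphs\<close>

text \<open>The vertex \<open>u\<^sub>i\<close> is represented by its subscript \<open>i\<close>, and \<open>j \<phi> i\<close>, \<open>a \<phi>\<close> stand for
  \<open>j\<^sup>\<phi>\<^sub>i\<close>, \<open>a\<^sup>\<phi>\<close>.  The values \<open>j 1 i\<close> are irrelevant, since \<open>E\<^sup>1\<close> is the path
  \<open>u\<^sub>1u\<^sub>2\<dots>u\<^sub>p\<close>.\<close>

definition path_edges :: "nat \<Rightarrow> (nat \<Rightarrow> nat) \<Rightarrow> nat set set" where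
  "path_edges p s = {{s i, s (i + 1)} | i. 1 \<le> i \<and> i \<le> p - 1}"

definition luv_E :: "nat \<Rightarrow> (nat \<Rightarrow> nat \<Rightarrow> nat) \<Rightarrow> nat \<Rightarrow> nat set set" where
  "luv_E p j \<phi> = (if \<phi> = 1 then path_edges p (\<lambda>i. i) else path_edges p (j \<phi>))"

definition luv_F :: "nat \<Rightarrow> (nat \<Rightarrow> nat) \<Rightarrow> nat \<Rightarrow> nat set set" where
  "luv_F p a \<phi> = {{1, 2 * a \<phi> + 1}, {p, 2 * a \<phi> + 1}}"

definition luv_data :: "nat \<Rightarrow> nat \<Rightarrow> (nat \<Rightarrow> nat \<Rightarrow> nat) \<Rightarrow> (nat \<Rightarrow> nat) \<Rightarrow> bool" where
  "luv_data p n j a \<longleftrightarrow>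
     odd p \<and> 9 \<le> p \<and> 2 \<le> n \<and>
     (\<forall>\<phi>\<in>{2..n}.
        bij_betw (j \<phi>) {1..p} {1..p} \<and> j \<phi> 1 = 1 \<and> j \<phi> p = p \<and>
        (\<forall>i\<in>{1..p - 1}. odd \<bar>int (j \<phi> (i + 1)) - int (j \<phi> i)\<bar> \<and>
                         3 \<le> \<bar>int (j \<phi> (i + 1)) - int (j \<phi> i)\<bar>)) \<and>
     (\<forall>\<phi>\<in>{2..n}. \<forall>\<psi>\<in>{2..n}. \<phi> \<noteq> \<psi> \<longrightarrow> luv_E p j \<phi> \<inter> luv_E p j \<psi> = {}) \<and>
     inj_on a {1..n} \<and> a ` {1..n} \<subseteq> {1..(p - 3) div 2}"

definition luv_graph ::
    "nat \<Rightarrow> nat \<Rightarrow> (nat \<Rightarrow> nat \<Rightarrow> nat) \<Rightarrow> (nat \<Rightarrow> nat) \<Rightarrow> (nat, nat set) multigraph" where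
  "luv_graph p n j a =
     \<lparr> verts = {1..p},
       edges = (\<Union>\<phi>\<in>{1..n}. luv_E p j \<phi> \<union> luv_F p a \<phi>),
       ends = (\<lambda>e. e) \<rparr>"

definition luv_S :: "nat \<Rightarrow> (nat \<Rightarrow> nat) \<Rightarrow> nat set" where
  "luv_S n a = {2 * a \<phi> + 1 | \<phi>. \<phi> \<in> {1..n}}"

definition luv_O :: "nat \<Rightarrow> nat \<Rightarrow> (nat \<Rightarrow> nat) \<Rightarrow> nat set" where
  "luv_O p n a = {i \<in> {1..p}. odd i} - luv_S n a"

definition luv_Q :: "nat \<Rightarrow> nat set" where
  "luv_Q p = {i \<in> {1..p}. even i}"

text \<open>Component \<open>c \<in> {1..t}\<close> of a disjoint union of \<open>t\<close> Luv graphs has its own data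
  \<open>j c\<close>, \<open>a c\<close>; its vertices are the pairs \<open>(c, i)\<close>.\<close>

definition luv_union ::
    "nat \<Rightarrow> nat \<Rightarrow> nat \<Rightarrow> (nat \<Rightarrow> nat \<Rightarrow> nat \<Rightarrow> nat) \<Rightarrow> (nat \<Rightarrow> nat \<Rightarrow> nat)
      \<Rightarrow> (nat \<times> nat, nat \<times> nat set) multigraph" where
  "luv_union t p n j a = disjoint_union {1..t} (\<lambda>c. luv_graph p n (j c) (a c))"

section \<open>The merged families\<close>

text \<open>\<open>v\<close> maps each vertex of \<open>S\<close> to the vertex of \<open>C\<close> it is to be merged with; as \<open>S\<close> has
  \<open>n\<close> elements, its values on \<open>S\<close> are the distinct vertices \<open>v\<^sub>1, \<dots>, v\<^sub>n\<close>.\<close>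

definition luv_matching ::
    "nat \<Rightarrow> nat \<Rightarrow> (nat \<Rightarrow> nat \<Rightarrow> nat) \<Rightarrow> (nat \<Rightarrow> nat) \<Rightarrow> nat set \<Rightarrow> (nat \<Rightarrow> nat) \<Rightarrow> bool" where
  "luv_matching p n j a C v \<longleftrightarrow>
     inj_on v (luv_S n a) \<and> v ` luv_S n a \<subseteq> C \<and>
     (\<forall>x\<in>v ` luv_S n a. \<forall>s\<in>luv_S n a.
        \<not> adjacent (luv_graph p n j a) x s \<and>
        \<not> (\<exists>w. adjacent (luv_graph p n j a) x w \<and> adjacent (luv_graph p n j a) s w))"

text \<open>In the following three families the argument \<open>m\<close> is the order of each component, i.e.
  \<open>p - n\<close>, \<open>p - n\<close> and \<open>p - n + 1\<close>, respectively.\<close>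

definition GL4 :: "nat \<Rightarrow> nat \<Rightarrow> nat \<Rightarrow> ('v, 'e) multigraph set" where
  "GL4 t m n = {G. t \<ge> 1 \<and> (\<exists>p j a v.
     m + n = p \<and>
     (\<forall>c\<in>{1..t}. luv_data p n (j c) (a c) \<and>
        luv_matching p n (j c) (a c) (luv_O p n (a c)) (v c)) \<and>
     arises_by_merging (luv_union t p n j a)
       {{(c, s), (c, v c s)} | c s. c \<in> {1..t} \<and> s \<in> luv_S n (a c)} G)}"

definition GL5 :: "nat \<Rightarrow> nat \<Rightarrow> nat \<Rightarrow> ('v, 'e) multigraph set" where
  "GL5 t m n = {G. t \<ge> 1 \<and> (\<exists>p j a v.
     m + n = p \<and>
     (\<forall>c\<in>{1..t}. luv_data p n (j c) (a c) \<and>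
        luv_matching p n (j c) (a c) (luv_Q p) (v c)) \<and>
     arises_by_merging (luv_union t p n j a)
       {{(c, s), (c, v c s)} | c s. c \<in> {1..t} \<and> s \<in> luv_S n (a c)} G)}"

definition GL6 :: "nat \<Rightarrow> nat \<Rightarrow> nat \<Rightarrow> ('v, 'e) multigraph set" where
  "GL6 t m n = {G. t \<ge> 1 \<and> (\<exists>p j a.
     m + n = p + 1 \<and>
     (\<forall>c\<in>{1..t}. luv_data p n (j c) (a c)) \<and>
     arises_by_merging (luv_union t p n j a)
       {{c} \<times> luv_S n (a c) | c. c \<in> {1..t}} G)}"

end

theory Submission
  imports Defs
begin

text \<open>A merged graph still contains the closed walk
  \<open>u\<^sub>1u\<^sub>2\<dots>u\<^bsub>2a+1\<^esub>u\<^sub>1\<close> of odd length, so at least three colours are needed.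
  For the converse, \<open>E\<^sup>\<phi> \<union> F\<^sup>\<phi>\<close> is a closed trail with \<open>p + 1\<close> edges.  List the edges of all
  these trails one after the other, each trail starting at its vertex in \<open>S\<close>, and label the list by
  \<open>N, 1, N - 1, 2, N - 2, \<dots>\<close>, where \<open>N = tn(p + 1)\<close>.  Two consecutive edges
  have sum \<open>N\<close> or \<open>N + 1\<close>, according to the parity of the vertex between them, and the first and
  last edge of a trail have sum \<open>N + (p + 1)/2\<close>.  Hence before merging the vertices in \<open>Q\<close>, \<open>O\<close>
  and \<open>S\<close> have the sums \<open>nN\<close>, \<open>n(N + 1)\<close> and \<open>n(N + 1) + N + (p + 1)/2\<close>.  Merging adds up the
  sums in each block, and the merged vertices form an independent set whose common sum is greater
  than the two other values.\<close>

section \<open>Labelings of merged graphs\<close>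

text \<open>With only two colours available, they would alternate along the walk, so every even
  position would repeat the colour of \<open>z 0\<close>. The closing condition at position
  \<open>2 * m\<close> forbids this.\<close>

lemma odd_closed_walk_colours:
  fixes col :: "'a \<Rightarrow> 'b"
  assumes "finite (col ` A)" and "\<And>i. i \<le> 2 * m \<Longrightarrow> z i \<in> A"
    and step: "\<And>i. i < 2 * m \<Longrightarrow> col (z i) \<noteq> col (z (Suc i))"
    and closed: "col (z 0) \<noteq> col (z (2 * m))"
  shows "3 \<le> card (col ` A)"
proof (rule ccontr)
  assume "\<not> 3 \<le> card (col ` A)"
  moreover have "card {x, y, w} \<le> card (col ` A)" if "{x, y, w} \<subseteq> col ` A" for x y w
    using that assms(1) by (rule card_mono[rotated])
  \<comment> \<open>Fewer than three colours means that any three of them contain a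
    repetition.\<close>
  ultimately have two: "x = y \<or> y = w \<or> x = w" if "{x, y, w} \<subseteq> col ` A" for x y w
    using that by (metis card_3_iff)
  have "col (z (2 * i)) = col (z 0)" if "i \<le> m" for i
    using that
  proof (induction i)
    case (Suc i)
    have "{col (z (2 * i)), col (z (Suc (2 * i))), col (z (Suc (Suc (2 * i))))} \<subseteq> col ` A"
      using assms(2) Suc.prems by auto
    moreover have "col (z (2 * i)) \<noteq> col (z (Suc (2 * i)))"
      "col (z (Suc (2 * i))) \<noteq> col (z (Suc (Suc (2 * i))))"
      using step Suc.prems by auto
    ultimately have "col (z (2 * i)) = col (z (Suc (Suc (2 * i))))"
      using two by blast
    then show ?case using Suc by simp
  qed simp
  then show False using closed by auto
qed

text \<open>This reduces the problem to the unmerged graph: \<open>\<sigma> x\<close> is the sum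
  received by the vertex of \<open>G\<close> that contains \<open>x\<close>. Since
  \<open>\<sigma>\<close> differs at the ends of every edge, no loops arise and the transported
  labeling is local antimagic. The odd closed walk survives in the quotient and bounds every
  labeling from below.\<close>

lemma chi_la_merging_eq_3:
  fixes H :: "('a, 'd) multigraph" and G :: "('v, 'e) multigraph"
  assumes merge: "arises_by_merging H \<B> G"
    and fin: "finite (verts H)" "finite (edges H)"
    and f: "bij_betw f (edges H) {1..card (edges H)}"
    and block_sum: "\<And>x. x \<in> verts H \<Longrightarrow>
      (\<Sum>y | y \<in> verts H \<and> (x = y \<or> (\<exists>B\<in>\<B>. x \<in> B \<and> y \<in> B)). vertex_sum H f y) = \<sigma> x"
    and proper: "\<And>e. e \<in> edges H \<Longrightarrow>
      \<exists>x\<in>verts H. \<exists>y\<in>verts H. ends H e = {x, y} \<and> \<sigma> x \<noteq> \<sigma> y"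
    and three: "card (\<sigma> ` verts H) \<le> 3"
    and walk: "\<And>i. i \<le> 2 * m \<Longrightarrow> z i \<in> verts H"
      "\<And>i. i < 2 * m \<Longrightarrow> adjacent H (z i) (z (Suc i))" "adjacent H (z 0) (z (2 * m))"
  shows "chi_la G = 3"
proof -
  obtain h g where hV: "verts G = h ` verts H"
    and h: "\<And>x y. x \<in> verts H \<Longrightarrow> y \<in> verts H \<Longrightarrow>
      h x = h y \<longleftrightarrow> x = y \<or> (\<exists>B\<in>\<B>. x \<in> B \<and> y \<in> B)"
    and g: "bij_betw g (edges H) (edges G)"
    and gh: "\<And>e. e \<in> edges H \<Longrightarrow> ends G (g e) = h ` ends H e"
    using merge unfolding arises_by_merging_def by metis
  have lower: "3 \<le> card (vertex_sum G F ` verts G)" if "local_antimagic G F" for F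
  proof -
    \<comment> \<open>Edges of \<open>H\<close> map to edges of \<open>G\<close>, so the sums of any
      local antimagic labeling of \<open>G\<close> pull back to a proper colouring of
      \<open>H\<close>.\<close>
    have adj: "vertex_sum G F (h x) \<noteq> vertex_sum G F (h y)"
      if xy: "x \<in> verts H" "y \<in> verts H" "adjacent H x y" for x y
    proof -
      obtain e where "e \<in> edges H" "ends H e = {x, y}"
        using xy unfolding adjacent_def by blast
      then have "adjacent G (h x) (h y)"
        using gh g unfolding adjacent_def by (auto dest: bij_betwE intro!: bexI[of _ "g e"])
      then show ?thesis
        using \<open>local_antimagic G F\<close> xy hV unfolding local_antimagic_def by blast
    qed
    have "3 \<le> card ((\<lambda>x. vertex_sum G F (h x)) ` verts H)"
      using fin walk adj by (intro odd_closed_walk_colours[of _ _ m z]) auto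
    then show ?thesis by (simp add: hV image_image)
  qed
  \<comment> \<open>The labels of \<open>f\<close> are carried over by the identification
    \<open>g\<close> of the edges.\<close>
  define F where "F = f \<circ> the_inv_into (edges H) g"
  have ginj: "inj_on g (edges H)" and gim: "g ` edges H = edges G"
    using g by (auto simp: bij_betw_def)
  have Fg: "F (g e) = f e" if "e \<in> edges H" for e
    using that ginj by (simp add: F_def the_inv_into_f_f)
  define blk where "blk x = {y \<in> verts H. h x = h y}" for x
  have blk_sum: "(\<Sum>y\<in>blk x. vertex_sum H f y) = \<sigma> x" if "x \<in> verts H" for x
  proof -
    have "blk x = {y. y \<in> verts H \<and> (x = y \<or> (\<exists>B\<in>\<B>. x \<in> B \<and> y \<in> B))}"
      using that h unfolding blk_def by blast
    then show ?thesis using block_sum that by simp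
  qed
  have \<sigma>_h: "\<sigma> x = \<sigma> y" if "x \<in> verts H" "y \<in> verts H" "h x = h y" for x y
    using that blk_sum unfolding blk_def by metis
  have sum_G: "vertex_sum G F (h x) = \<sigma> x" if x: "x \<in> verts H" for x
  proof -
    have "vertex_sum G F (h x) = (\<Sum>e | e \<in> edges H \<and> h x \<in> h ` ends H e. f e)"
      unfolding vertex_sum_def
    proof (rule sum.reindex_cong[symmetric, OF _ _ _, symmetric])
      show "inj_on g {e \<in> edges H. h x \<in> h ` ends H e}"
        using ginj by (auto simp: inj_on_def)
      show "{e \<in> edges G. h x \<in> ends G e} = g ` {e \<in> edges H. h x \<in> h ` ends H e}"
        using gh unfolding gim[symmetric] by auto
      show "F (g e) = f e" if "e \<in> {e \<in> edges H. h x \<in> h ` ends H e}" for e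
        using that Fg by auto
    qed
    \<comment> \<open>An edge of \<open>G\<close> at \<open>h x\<close> comes from an edge of
      \<open>H\<close> with an end in the block of \<open>x\<close>; \<open>proper\<close>
      guarantees that this end is a vertex of \<open>H\<close>.\<close>
    also have "{e. e \<in> edges H \<and> h x \<in> h ` ends H e} = (\<Union>y\<in>blk x. {e \<in> edges H. y \<in> ends H e})"
      using proper unfolding blk_def by fastforce
    also have "sum f \<dots> = (\<Sum>y\<in>blk x. vertex_sum H f y)"
      unfolding vertex_sum_def
    proof (rule sum.UNION_disjoint)
      \<comment> \<open>An edge counted twice would have both ends in one block, where
        \<open>\<sigma>\<close> is constant, against \<open>proper\<close>.\<close>
      show "\<forall>y\<in>blk x. \<forall>w\<in>blk x. y \<noteq> w \<longrightarrow>
          {e \<in> edges H. y \<in> ends H e} \<inter> {e \<in> edges H. w \<in> ends H e} = {}"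
      proof (intro ballI impI, rule ccontr)
        fix y w assume yw: "y \<in> blk x" "w \<in> blk x" "y \<noteq> w"
          and "{e \<in> edges H. y \<in> ends H e} \<inter> {e \<in> edges H. w \<in> ends H e} \<noteq> {}"
        then obtain e where "e \<in> edges H" "y \<in> ends H e" "w \<in> ends H e" by blast
        then have "\<sigma> y \<noteq> \<sigma> w" using proper[of e] yw(3) by fastforce
        moreover have "\<sigma> y = \<sigma> w"
          using yw by (intro \<sigma>_h) (auto simp: blk_def)
        ultimately show False by contradiction
      qed
    qed (use fin in \<open>auto simp: blk_def\<close>)
    finally show ?thesis using blk_sum x by simp
  qed
  have "card (edges G) = card (edges H)"
    using g by (simp add: bij_betw_same_card)
  then have "bij_betw F (edges G) {1..card (edges G)}"
    unfolding F_def using bij_betw_trans[OF bij_betw_the_inv_into[OF g] f] by simp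
  moreover have "vertex_sum G F u \<noteq> vertex_sum G F w" if uw: "adjacent G u w" for u w
  proof -
    obtain e where e: "e \<in> edges H" "h ` ends H e = {u, w}"
      using uw gh gim unfolding adjacent_def by (metis imageE)
    obtain x y where xy: "x \<in> verts H" "y \<in> verts H" "ends H e = {x, y}" "\<sigma> x \<noteq> \<sigma> y"
      using proper[OF e(1)] by blast
    then have "{h x, h y} = {u, w}" using e by simp
    then show ?thesis using sum_G xy by (metis doubleton_eq_iff)
  qed
  ultimately have F: "local_antimagic G F"
    unfolding local_antimagic_def by blast
  have "vertex_sum G F ` verts G = \<sigma> ` verts H"
    using sum_G by (auto simp: hV image_image)
  then have "card (vertex_sum G F ` verts G) = 3"
    using three lower[OF F] by simp
  then show ?thesis
    unfolding chi_la_def using F lower by (intro cInf_eq_minimum) force+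
qed

section \<open>The zigzag labeling of a list of edges\<close>

definition zigzag :: "nat \<Rightarrow> nat \<Rightarrow> nat" where
  "zigzag N x = (if odd x then x div 2 + 1 else N - x div 2)"

text \<open>For even \<open>N\<close> the even positions take the upper half of the labels and the
  odd positions the lower half. Injectivity and a comparison of cardinalities suffice.\<close>

lemma bij_betw_zigzag:
  assumes "even N"
  shows "bij_betw (zigzag N) {..<N} {1..N}"
proof -
  have inj: "inj_on (zigzag N) {..<N}"
    using assms by (auto simp: inj_on_def zigzag_def elim!: evenE oddE split: if_splits)
  moreover have "zigzag N ` {..<N} \<subseteq> {1..N}"
    using assms by (auto simp: zigzag_def elim!: evenE oddE)
  ultimately show ?thesis
    by (simp add: bij_betw_def card_image card_subset_eq)
qed

text \<open>An even offset \<open>b\<close> preserves the parity of positions. At neighbouring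
  positions the descending and the ascending terms cancel up to an error of 0 or 1, which the parity
  of \<open>k\<close> decides.\<close>

lemma zigzag_sums:
  assumes "even b" "b + k \<le> N" "1 \<le> k"
  shows "zigzag N (b + (k - 1)) + zigzag N (b + k) = N + k mod 2"
proof (cases "odd k")
  case True
  then show ?thesis using assms by (auto simp: zigzag_def elim!: evenE oddE)
next
  case False
  then obtain i where "k = 2 * Suc i"
    using assms(3) by (metis evenE mult_0_right not0_implies_Suc not_one_le_zero)
  then show ?thesis using assms by (auto simp: zigzag_def elim!: evenE)
qed

text \<open>Half of \<open>b\<close> is subtracted at the first position and, as \<open>p\<close> is
  odd, added at the last one. The offset cancels, so all trails get the same value here.\<close>

lemma zigzag_ends:
  assumes "even b" "b \<le> N" "odd p"
  shows "zigzag N b + zigzag N (b + p) = N + (p + 1) div 2"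
  using assms by (auto simp: zigzag_def elim!: evenE oddE)

section \<open>A single Luv graph\<close>

locale luv =
  fixes p n :: nat and j :: "nat \<Rightarrow> nat \<Rightarrow> nat" and a :: "nat \<Rightarrow> nat"
  assumes data: "luv_data p n j a"
begin

text \<open>The vertex sequence of the path \<open>E\<^sup>\<phi>\<close>. The values of
  \<open>j 1\<close> carry no information, so the case \<open>\<phi> = 1\<close> is filled in to
  treat all paths uniformly.\<close>

definition s :: "nat \<Rightarrow> nat \<Rightarrow> nat" where
  "s \<phi> = (if \<phi> = 1 then (\<lambda>i. i) else j \<phi>)"

text \<open>Traversing the path \<open>E\<^sup>\<phi>\<close> and returning through \<open>F\<^sup>\<phi>\<close> is a closed trail of
  length \<open>p + 1\<close>, here started at its vertex in \<open>S\<close>.\<close>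

definition trail :: "nat \<Rightarrow> nat \<Rightarrow> nat" where
  "trail \<phi> k = (if k = 0 \<or> k = p + 1 then 2 * a \<phi> + 1 else s \<phi> k)"

definition trail_edge :: "nat \<Rightarrow> nat \<Rightarrow> nat set" where
  "trail_edge \<phi> k = {trail \<phi> k, trail \<phi> (k + 1)}"

section \<open>Ranges and parities along the paths\<close>

lemma params: "odd p" "9 \<le> p" "2 \<le> n"
  and a_inj: "inj_on a {1..n}"
  and a_range: "\<phi> \<in> {1..n} \<Longrightarrow> 1 \<le> a \<phi> \<and> 2 * a \<phi> + 1 < p"
proof -
  show "odd p" "9 \<le> p" "2 \<le> n" "inj_on a {1..n}"
    using data unfolding luv_data_def by blast+
  have range: "a ` {1..n} \<subseteq> {1..(p - 3) div 2}"
    using data unfolding luv_data_def by blast+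
  \<comment> \<open>The upper bound on \<open>a\<close> gives
    \<open>2 * a \<phi> + 1 \<le> p - 2\<close>, so a vertex in \<open>S\<close> is never an end of
    the paths.\<close>
  show "\<phi> \<in> {1..n} \<Longrightarrow> 1 \<le> a \<phi> \<and> 2 * a \<phi> + 1 < p"
    using subsetD[OF range imageI[of \<phi>]] by auto
qed

lemma j_props:
  assumes "\<phi> \<in> {2..n}"
  shows "bij_betw (j \<phi>) {1..p} {1..p}" "j \<phi> 1 = 1" "j \<phi> p = p"
    "\<And>i. i \<in> {1..p - 1} \<Longrightarrow> odd \<bar>int (j \<phi> (i + 1)) - int (j \<phi> i)\<bar>"
    "\<And>i. i \<in> {1..p - 1} \<Longrightarrow> 3 \<le> \<bar>int (j \<phi> (i + 1)) - int (j \<phi> i)\<bar>"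
  using data assms unfolding luv_data_def by blast+

lemma s_props:
  assumes "\<phi> \<in> {1..n}"
  shows "bij_betw (s \<phi>) {1..p} {1..p}" "s \<phi> 1 = 1" "s \<phi> p = p"
  using j_props[of \<phi>] assms by (auto simp: s_def bij_betw_def)

lemma s_range: "\<phi> \<in> {1..n} \<Longrightarrow> k \<in> {1..p} \<Longrightarrow> s \<phi> k \<in> {1..p}"
  using s_props(1) by (blast dest: bij_betwE)

text \<open>Every path starts at subscript 1 and each step changes the subscript by an odd amount.
  Sums that depend on the parity of a position thereby depend on the vertex only.\<close>

lemma s_parity:
  assumes "\<phi> \<in> {1..n}" "1 \<le> k" "k \<le> p"
  shows "odd (s \<phi> k) = odd k"
  using assms(2,3)
proof (induction k rule: dec_induct)
  case base
  then show ?case using s_props(2) assms by simp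
next
  case (step k)
  have "odd (s \<phi> (k + 1)) \<noteq> odd (s \<phi> k)"
  proof (cases "\<phi> = 1")
    case False
    then have "odd \<bar>int (j \<phi> (k + 1)) - int (j \<phi> k)\<bar>"
      using step assms by (intro j_props) auto
    then show ?thesis using False by (auto simp: s_def)
  qed (simp add: s_def)
  then show ?case using step by auto
qed

section \<open>Edge-disjointness of the closed trails\<close>

lemma luv_E_eq: "luv_E p j \<phi> = path_edges p (s \<phi>)"
  by (simp add: luv_E_def s_def)

text \<open>Edges of the first path join consecutive subscripts, whereas the other paths only make
  steps of size at least 3. Disjointness among those other paths is part of
  \<open>luv_data\<close>.\<close>

lemma luv_E_disjoint:
  assumes "\<phi> \<in> {1..n}" "\<psi> \<in> {1..n}" "\<phi> \<noteq> \<psi>"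
  shows "luv_E p j \<phi> \<inter> luv_E p j \<psi> = {}"
proof -
  have one: "luv_E p j 1 \<inter> luv_E p j \<theta> = {}" if \<theta>: "\<theta> \<in> {2..n}" for \<theta>
  proof (rule ccontr)
    assume "luv_E p j 1 \<inter> luv_E p j \<theta> \<noteq> {}"
    then obtain i k where "{i, i + 1} = {j \<theta> k, j \<theta> (k + 1)}" "k \<in> {1..p - 1}"
      using \<theta> by (auto simp: luv_E_def path_edges_def)
    then show False using j_props(5)[OF \<theta>, of k] by (auto simp: doubleton_eq_iff)
  qed
  show ?thesis
  proof (cases "\<phi> = 1 \<or> \<psi> = 1")
    case True
    then show ?thesis using one[of \<phi>] one[of \<psi>] assms by auto
  next
    case False
    then have "\<phi> \<in> {2..n}" "\<psi> \<in> {2..n}" using assms by auto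
    then show ?thesis using data assms(3) unfolding luv_data_def by blast
  qed
qed

text \<open>Edge indices run from 0 to \<open>p\<close>. Since every path leads from 1 to
  \<open>p\<close>, the first and the last edge are the two edges of
  \<open>F\<^sup>\<phi>\<close>.\<close>

lemma trail_edge_cases:
  assumes "\<phi> \<in> {1..n}"
  shows "trail_edge \<phi> 0 = {1, 2 * a \<phi> + 1}" "trail_edge \<phi> p = {p, 2 * a \<phi> + 1}"
    "1 \<le> k \<Longrightarrow> k < p \<Longrightarrow> trail_edge \<phi> k = {s \<phi> k, s \<phi> (k + 1)}"
  using s_props[OF assms] params by (auto simp: trail_edge_def trail_def)

lemma trail_edge_image:
  assumes "\<phi> \<in> {1..n}"
  shows "trail_edge \<phi> ` {..p} = luv_E p j \<phi> \<union> luv_F p a \<phi>"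
proof -
  have "{..p} = {1..p - 1} \<union> {0, p}" using params by auto
  moreover have "trail_edge \<phi> ` {1..p - 1} = path_edges p (s \<phi>)"
  proof -
    have "trail_edge \<phi> ` {1..p - 1} = (\<lambda>k. {s \<phi> k, s \<phi> (k + 1)}) ` {1..p - 1}"
      using trail_edge_cases(3)[OF assms] by (intro image_cong) auto
    then show ?thesis by (auto simp: path_edges_def)
  qed
  ultimately show ?thesis
    by (simp only: image_Un luv_E_eq luv_F_def image_insert image_empty
        trail_edge_cases(1,2)[OF assms])
qed

text \<open>Edges of a Luv graph are vertex sets, so coincidences must be excluded before labels can
  be assigned by position. Edges of \<open>F\<close> are told apart by \<open>a\<close> and by their
  end 1 or \<open>p\<close>, path edges by \<open>luv_E_disjoint\<close> and injectivity of
  \<open>s\<close>.\<close>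

lemma trail_edge_inj:
  assumes \<phi>: "\<phi> \<in> {1..n}" and \<psi>: "\<psi> \<in> {1..n}" and kl: "k \<le> p" "l \<le> p"
    and eq: "trail_edge \<phi> k = trail_edge \<psi> l"
  shows "\<phi> = \<psi> \<and> k = l"
proof -
  \<comment> \<open>An edge of \<open>F\<close> has two odd ends, while a path edge has ends of
    opposite parity.\<close>
  have mixed: False
    if "\<theta> \<in> {1..n}" "\<eta> \<in> {1..n}" "i = 0 \<or> i = p" "1 \<le> m" "m < p"
      "trail_edge \<theta> i = trail_edge \<eta> m" for \<theta> \<eta> i m
  proof -
    have "\<forall>x\<in>trail_edge \<theta> i. odd x"
      using that(3) trail_edge_cases(1,2)[OF that(1)] params by auto
    moreover have "s \<eta> m \<in> trail_edge \<eta> m" "s \<eta> (m + 1) \<in> trail_edge \<eta> m"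
      using trail_edge_cases(3)[OF that(2,4,5)] by auto
    moreover have "odd (s \<eta> m) \<noteq> odd (s \<eta> (m + 1))"
      using s_parity[OF that(2), of m] s_parity[OF that(2), of "m + 1"] that(4,5) by simp
    ultimately show False using that(6) by blast
  qed
  consider "k = 0 \<or> k = p" "l = 0 \<or> l = p" | "k = 0 \<or> k = p" "1 \<le> l" "l < p"
    | "1 \<le> k" "k < p" "l = 0 \<or> l = p" | "1 \<le> k" "k < p" "1 \<le> l" "l < p"
    using kl by linarith
  then show ?thesis
  proof cases
    case 1
    then have "a \<phi> = a \<psi> \<and> k = l"
      using eq a_range[OF \<phi>] a_range[OF \<psi>] \<phi> \<psi> params
      by (auto simp: trail_edge_cases doubleton_eq_iff)
    then show ?thesis using a_inj \<phi> \<psi> by (auto dest: inj_onD)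
  next
    case 2
    then show ?thesis using mixed \<phi> \<psi> eq by blast
  next
    case 3
    then show ?thesis using mixed \<phi> \<psi> eq[symmetric] by blast
  next
    case 4
    have "trail_edge \<phi> k \<in> luv_E p j \<phi>" "trail_edge \<psi> l \<in> luv_E p j \<psi>"
      using 4 \<phi> \<psi> by (auto simp: luv_E_eq path_edges_def trail_edge_cases)
    then have same: "\<phi> = \<psi>" using luv_E_disjoint[OF \<phi> \<psi>] eq by auto
    have inj: "x = y" if "s \<phi> x = s \<phi> y" "x \<in> {1..p}" "y \<in> {1..p}" for x y
      using that s_props(1)[OF \<phi>] by (auto simp: bij_betw_def dest: inj_onD)
    have "{s \<phi> k, s \<phi> (k + 1)} = {s \<phi> l, s \<phi> (l + 1)}"
      using 4 eq same \<phi> by (simp add: trail_edge_cases)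
    then show ?thesis
      using inj[of k l] inj[of k "l + 1"] inj[of "k + 1" l] 4 same by (auto simp: doubleton_eq_iff)
  qed
qed

lemma bij_betw_trail_edge:
  "bij_betw (\<lambda>(\<phi>, k). trail_edge \<phi> k) ({1..n} \<times> {..p}) (edges (luv_graph p n j a))"
proof -
  have "inj_on (\<lambda>(\<phi>, k). trail_edge \<phi> k) ({1..n} \<times> {..p})"
    using trail_edge_inj by (auto simp: inj_on_def)
  moreover have "(\<lambda>(\<phi>, k). trail_edge \<phi> k) ` ({1..n} \<times> {..p}) = (\<Union>\<phi>\<in>{1..n}. trail_edge \<phi> ` {..p})"
    by auto
  moreover have "\<dots> = edges (luv_graph p n j a)"
    using trail_edge_image by (simp add: luv_graph_def)
  ultimately show ?thesis by (simp add: bij_betw_def)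
qed

section \<open>Ends of edges and vertex sums\<close>

lemma luv_S_range: "luv_S n a \<subseteq> {i. odd i \<and> 1 < i \<and> i < p}"
  using a_range by (fastforce simp: luv_S_def)

text \<open>Path edges change parity, and edges of \<open>F\<close> join an end of the paths to
  \<open>S\<close>. This description serves to check properness and independence after
  merging.\<close>

lemma edge_cases:
  assumes "e \<in> edges (luv_graph p n j a)"
  obtains x y where "x \<in> {1..p}" "y \<in> {1..p}" "e = {x, y}"
    "odd x \<noteq> odd y \<or> x \<in> {1, p} \<and> y \<in> luv_S n a"
proof -
  obtain \<phi> where \<phi>: "\<phi> \<in> {1..n}" "e \<in> luv_E p j \<phi> \<union> luv_F p a \<phi>"
    using assms by (auto simp: luv_graph_def)
  from \<phi>(2) consider "e \<in> luv_E p j \<phi>" | "e \<in> luv_F p a \<phi>" by blast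
  then show thesis
  proof cases
    case 1
    then obtain k where k: "e = {s \<phi> k, s \<phi> (k + 1)}" "1 \<le> k" "k \<le> p - 1"
      by (auto simp: luv_E_eq path_edges_def)
    then have "odd (s \<phi> k) \<noteq> odd (s \<phi> (k + 1))"
      using s_parity[OF \<phi>(1)] params by simp
    then show thesis
      using that[of "s \<phi> k" "s \<phi> (k + 1)"] k s_range[OF \<phi>(1)] params by auto
  next
    case 2
    then obtain x where "x \<in> {1, p}" "e = {x, 2 * a \<phi> + 1}" by (auto simp: luv_F_def)
    moreover have "2 * a \<phi> + 1 \<in> luv_S n a" using \<phi>(1) by (auto simp: luv_S_def)
    moreover have "x \<in> {1..p}" "2 * a \<phi> + 1 \<in> {1..p}"
      using \<open>x \<in> {1, p}\<close> a_range[OF \<phi>(1)] params by auto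
    ultimately show thesis using that by blast
  qed
qed

text \<open>The path visits \<open>i\<close> exactly once, at some position \<open>k\<close>, which
  yields the edges \<open>k - 1\<close> and \<open>k\<close>. The starting vertex of the trail also
  meets the first and the last edge.\<close>

lemma vertex_sum_trail:
  assumes "i \<in> {1..p}" and \<phi>: "\<phi> \<in> {1..n}"
  obtains k where "1 \<le> k" "k \<le> p" "odd k = odd i"
    "(\<Sum>k | k \<le> p \<and> i \<in> trail_edge \<phi> k. g k :: nat) =
       g (k - 1) + g k + (if i = 2 * a \<phi> + 1 then g 0 + g p else 0)"
proof -
  obtain k where k: "k \<in> {1..p}" "s \<phi> k = i"
    using s_props(1)[OF \<phi>] assms(1) unfolding bij_betw_def by (metis imageE)
  have inj: "s \<phi> l = i \<longleftrightarrow> l = k" if "l \<in> {1..p}" for l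
    using that k s_props(1)[OF \<phi>] by (auto simp: bij_betw_def dest: inj_onD)
  have trail_iff: "trail \<phi> l = i \<longleftrightarrow>
      l = k \<or> (l = 0 \<or> l = p + 1) \<and> i = 2 * a \<phi> + 1" if "l \<le> p + 1" for l
    using that inj[of l] k by (auto simp: trail_def)
  have "{l. l \<le> p \<and> i \<in> trail_edge \<phi> l} =
      {k - 1, k} \<union> (if i = 2 * a \<phi> + 1 then {0, p} else {})"
    using k(1) by (auto simp: trail_edge_def trail_iff eq_commute[of i])
  \<comment> \<open>A vertex in \<open>S\<close> is interior to the path, so the four edge indices
    are distinct.\<close>
  moreover have "k - 1 \<notin> {0, p} \<and> k \<notin> {0, p} \<and> k - 1 \<noteq> k" if "i = 2 * a \<phi> + 1"
  proof -
    have "k \<noteq> 1" "k \<noteq> p" using that k(2) s_props[OF \<phi>] a_range[OF \<phi>] by auto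
    then show ?thesis using k(1) by auto
  qed
  moreover have "k - 1 \<noteq> k" "0 \<noteq> p" using k(1) by auto
  ultimately have "(\<Sum>k | k \<le> p \<and> i \<in> trail_edge \<phi> k. g k :: nat) =
       g (k - 1) + g k + (if i = 2 * a \<phi> + 1 then g 0 + g p else 0)"
    using k(1) by auto
  then show thesis using that k s_parity[OF \<phi>] by auto
qed

text \<open>Each of the \<open>n\<close> trails may start at its own even offset
  \<open>b \<phi>\<close>: its contribution to the sum at \<open>i\<close> does not depend on the
  offset.\<close>

lemma vertex_sum_zigzag:
  assumes i: "i \<in> {1..p}"
    and b: "\<And>\<phi>. \<phi> \<in> {1..n} \<Longrightarrow> even (b \<phi>) \<and> b \<phi> + p \<le> N"
    and f: "\<And>\<phi> k. \<phi> \<in> {1..n} \<Longrightarrow> k \<le> p \<Longrightarrow> f (trail_edge \<phi> k) = zigzag N (b \<phi> + k)"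
  shows "vertex_sum (luv_graph p n j a) f i =
    n * (N + i mod 2) + (if i \<in> luv_S n a then N + (p + 1) div 2 else 0)"
proof -
  let ?D = "{1..n} \<times> {..p}" and ?w = "N + (p + 1) div 2"
  have image: "{e \<in> edges (luv_graph p n j a). i \<in> ends (luv_graph p n j a) e} =
      (\<lambda>(\<phi>, k). trail_edge \<phi> k) ` (SIGMA \<phi>:{1..n}. {k. k \<le> p \<and> i \<in> trail_edge \<phi> k})"
  proof -
    have "edges (luv_graph p n j a) = (\<lambda>(\<phi>, k). trail_edge \<phi> k) ` ({1..n} \<times> {..p})"
      using bij_betw_trail_edge by (simp add: bij_betw_def)
    moreover have "ends (luv_graph p n j a) e = e" for e by (simp add: luv_graph_def)
    ultimately show ?thesis by auto
  qed
  have "vertex_sum (luv_graph p n j a) f i =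
      (\<Sum>(\<phi>, k)\<in>(SIGMA \<phi>:{1..n}. {k. k \<le> p \<and> i \<in> trail_edge \<phi> k}). f (trail_edge \<phi> k))"
    unfolding vertex_sum_def image
  proof (subst sum.reindex)
    show "inj_on (\<lambda>(\<phi>, k). trail_edge \<phi> k) (SIGMA \<phi>:{1..n}. {k. k \<le> p \<and> i \<in> trail_edge \<phi> k})"
      using bij_betw_trail_edge unfolding bij_betw_def by (rule inj_on_subset[OF conjunct1]) auto
  qed (auto simp: case_prod_unfold)
  also have "\<dots> = (\<Sum>\<phi>=1..n. \<Sum>k | k \<le> p \<and> i \<in> trail_edge \<phi> k. f (trail_edge \<phi> k))"
    by (subst sum.Sigma) auto
  also have "\<dots> = (\<Sum>\<phi>=1..n. (N + i mod 2) + (if i = 2 * a \<phi> + 1 then ?w else 0))"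
  proof (rule sum.cong[OF refl])
    fix \<phi> assume \<phi>: "\<phi> \<in> {1..n}"
    obtain k where k: "1 \<le> k" "k \<le> p" "odd k = odd i"
      "(\<Sum>k | k \<le> p \<and> i \<in> trail_edge \<phi> k. zigzag N (b \<phi> + k)) =
        zigzag N (b \<phi> + (k - 1)) + zigzag N (b \<phi> + k) +
        (if i = 2 * a \<phi> + 1 then zigzag N (b \<phi> + 0) + zigzag N (b \<phi> + p) else 0)"
      by (rule vertex_sum_trail[OF i \<phi>])
    have "zigzag N (b \<phi> + (k - 1)) + zigzag N (b \<phi> + k) = N + i mod 2"
      using zigzag_sums[of "b \<phi>" k N] b[OF \<phi>] k by (simp add: mod2_eq_if)
    moreover have "zigzag N (b \<phi> + 0) + zigzag N (b \<phi> + p) = ?w"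
      using zigzag_ends[of "b \<phi>" N p] b[OF \<phi>] params by simp
    moreover have "(\<Sum>k | k \<le> p \<and> i \<in> trail_edge \<phi> k. f (trail_edge \<phi> k)) =
        (\<Sum>k | k \<le> p \<and> i \<in> trail_edge \<phi> k. zigzag N (b \<phi> + k))"
      using f[OF \<phi>] by (intro sum.cong) auto
    ultimately show "(\<Sum>k | k \<le> p \<and> i \<in> trail_edge \<phi> k. f (trail_edge \<phi> k)) =
        (N + i mod 2) + (if i = 2 * a \<phi> + 1 then ?w else 0)"
      using k(4) by presburger
  qed
  also have "\<dots> = n * (N + i mod 2) + (\<Sum>\<phi>=1..n. if i = 2 * a \<phi> + 1 then ?w else 0)"
    by (subst sum.distrib) simp
  \<comment> \<open>By injectivity of \<open>a\<close>, at most one trail starts at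
    \<open>i\<close>.\<close>
  also have "(\<Sum>\<phi>=1..n. if i = 2 * a \<phi> + 1 then ?w else 0) = (if i \<in> luv_S n a then ?w else 0)"
  proof (cases "i \<in> luv_S n a")
    case True
    then obtain \<psi> where \<psi>: "\<psi> \<in> {1..n}" "i = 2 * a \<psi> + 1" by (auto simp: luv_S_def)
    then have "(\<Sum>\<phi>=1..n. if i = 2 * a \<phi> + 1 then ?w else 0) =
        (\<Sum>\<phi>=1..n. if \<phi> = \<psi> then ?w else 0)"
      using inj_on_eq_iff[OF a_inj] by (intro sum.cong) auto
    then show ?thesis using True \<psi> by simp
  qed (auto simp: luv_S_def intro!: sum.neutral)
  finally show ?thesis .
qed

text \<open>The walk follows the first path from 1 to \<open>2 * a 1 + 1\<close>, and an edge of
  \<open>F\<close> closes it; thus \<open>m\<close> is \<open>a 1\<close>.\<close>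

lemma odd_closed_walk:
  obtains m where "2 * m < p" "\<And>i. i < 2 * m \<Longrightarrow> adjacent (luv_graph p n j a) (Suc i) (Suc (Suc i))"
    "adjacent (luv_graph p n j a) 1 (Suc (2 * m))"
proof
  have 1: "1 \<in> {1..n}" using params by simp
  show "2 * a 1 < p" using a_range[OF 1] by simp
  have sub: "luv_E p j 1 \<union> luv_F p a 1 \<subseteq> edges (luv_graph p n j a)"
    using 1 unfolding luv_graph_def by auto
  show "adjacent (luv_graph p n j a) (Suc i) (Suc (Suc i))" if "i < 2 * a 1" for i
  proof -
    have "{Suc i, Suc (Suc i)} \<in> luv_E p j 1"
      unfolding luv_E_def path_edges_def using that a_range[OF 1] by (auto intro!: exI[of _ "Suc i"])
    then show ?thesis using sub by (auto simp: adjacent_def luv_graph_def)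
  qed
  show "adjacent (luv_graph p n j a) 1 (Suc (2 * a 1))"
    using sub by (auto simp: adjacent_def luv_graph_def luv_F_def)
qed

lemma card_luv_S: "card (luv_S n a) = n"
proof -
  have "luv_S n a = (\<lambda>\<phi>. 2 * a \<phi> + 1) ` {1..n}" by (auto simp: luv_S_def)
  moreover have "inj_on (\<lambda>\<phi>. 2 * a \<phi> + 1) {1..n}"
    using inj_on_eq_iff[OF a_inj] by (intro inj_onI) auto
  ultimately show ?thesis by (simp add: card_image)
qed

end

section \<open>Disjoint unions of Luv graphs\<close>

lemma mixed_radix_inj:
  fixes x y b :: nat
  assumes "y < b" "y' < b" "x * b + y = x' * b + y'"
  shows "x = x' \<and> y = y'"
proof -
  have "(x * b + y) div b = x" "(x' * b + y') div b = x'" using assms(1,2) by simp_all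
  then have "x = x'" using assms(3) by simp
  then show ?thesis using assms(3) by simp
qed

lemma mixed_radix_less:
  fixes x y b :: nat
  assumes "x < m" "y < b"
  shows "x * b + y < m * b"
proof -
  have "x * b + y < Suc x * b" using assms by simp
  also have "\<dots> \<le> m * b" using assms by (intro mult_le_mono1) simp
  finally show ?thesis .
qed

text \<open>The place of edge \<open>k\<close> of trail \<open>\<phi>\<close> in component
  \<open>c\<close>, counted from 0. Decoding to base \<open>p + 1\<close> and then to base
  \<open>n\<close> gives injectivity; counting gives surjectivity.\<close>

lemma bij_betw_mixed_radix:
  fixes t n p :: nat
  shows "bij_betw (\<lambda>(c, \<phi>, k). ((c - 1) * n + (\<phi> - 1)) * (p + 1) + k)
     ({1..t} \<times> {1..n} \<times> {..p}) {..<t * n * (p + 1)}"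
proof -
  let ?f = "\<lambda>(c, \<phi>, k). ((c - 1) * n + (\<phi> - 1)) * (p + 1) + k"
  let ?D = "{1..t} \<times> {1..n} \<times> {..p}"
  have less: "((c - 1) * n + (\<phi> - 1)) * (p + 1) + k < t * n * (p + 1)"
    if "c \<in> {1..t}" "\<phi> \<in> {1..n}" "k \<le> p" for c \<phi> k
    using that by (intro mixed_radix_less) (auto intro!: mixed_radix_less)
  have inj: "inj_on ?f ?D"
  proof (rule inj_onI)
    fix x y assume xy: "x \<in> ?D" "y \<in> ?D" "?f x = ?f y"
    obtain c \<phi> k c' \<phi>' k' where x: "x = (c, \<phi>, k)" and y: "y = (c', \<phi>', k')"
      by (metis prod_cases3)
    have D: "c \<in> {1..t}" "\<phi> \<in> {1..n}" "k \<in> {..p}" "c' \<in> {1..t}" "\<phi>' \<in> {1..n}" "k' \<in> {..p}"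
      using xy(1,2) by (auto simp: x y)
    have eq: "((c - 1) * n + (\<phi> - 1)) * (p + 1) + k = ((c' - 1) * n + (\<phi>' - 1)) * (p + 1) + k'"
      using xy(3) by (simp only: x y prod.case)
    have 1: "(c - 1) * n + (\<phi> - 1) = (c' - 1) * n + (\<phi>' - 1) \<and> k = k'"
      by (rule mixed_radix_inj[OF _ _ eq]) (use D in auto)
    moreover have "c - 1 = c' - 1 \<and> \<phi> - 1 = \<phi>' - 1"
      by (rule mixed_radix_inj[OF _ _ conjunct1[OF 1]]) (use D in auto)
    ultimately have "c = c'" "\<phi> = \<phi>'" "k = k'" using D by auto
    then show "x = y" by (simp only: x y)
  qed
  have "?f ` ?D = {..<t * n * (p + 1)}"
  proof (rule card_subset_eq)
    show "?f ` ?D \<subseteq> {..<t * n * (p + 1)}"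
      using less by (intro image_subsetI, clarify) (simp only: prod.case lessThan_iff atMost_iff)
    show "card (?f ` ?D) = card {..<t * n * (p + 1)}"
      unfolding card_image[OF inj] by (simp add: algebra_simps)
  qed simp
  with inj show ?thesis by (rule bij_betw_imageI)
qed

section \<open>The labeling of the whole union\<close>

lemma vertex_sum_disjoint_union:
  assumes "c \<in> I"
  shows "vertex_sum (disjoint_union I H) f (c, v) = vertex_sum (H c) (\<lambda>e. f (c, e)) v"
proof -
  have "{e \<in> edges (disjoint_union I H). (c, v) \<in> ends (disjoint_union I H) e} =
      Pair c ` {e \<in> edges (H c). v \<in> ends (H c) e}"
    using assms by (auto simp: disjoint_union_def)
  then show ?thesis
    unfolding vertex_sum_def by (simp add: sum.reindex inj_on_def)
qed

text \<open>The sum at vertex \<open>i\<close> before merging; \<open>t * n * (p + 1)\<close> is the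
  total number of edges.\<close>

definition luv_weight :: "nat \<Rightarrow> nat \<Rightarrow> nat \<Rightarrow> nat set \<Rightarrow> nat \<Rightarrow> nat" where
  "luv_weight t p n S i =
     n * (t * n * (p + 1) + i mod 2) + (if i \<in> S then t * n * (p + 1) + (p + 1) div 2 else 0)"

text \<open>All offsets \<open>base c \<phi>\<close> are multiples of the even number
  \<open>p + 1\<close>, so every trail meets the zigzag pattern in the same phase and
  \<open>vertex_sum_zigzag\<close> applies in each component.\<close>

lemma luv_union_labeling:
  assumes data: "\<And>c. c \<in> {1..t} \<Longrightarrow> luv_data p n (j c) (a c)" and "odd p"
  obtains f where "bij_betw f (edges (luv_union t p n j a)) {1..card (edges (luv_union t p n j a))}"
    "\<And>c i. c \<in> {1..t} \<Longrightarrow> i \<in> {1..p} \<Longrightarrow>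
      vertex_sum (luv_union t p n j a) f (c, i) = luv_weight t p n (luv_S n (a c)) i"
proof -
  define N where "N = t * n * (p + 1)"
  let ?D = "{1..t} \<times> {1..n} \<times> {..p}"
  let ?U = "luv_union t p n j a"
  define base where "base c \<phi> = ((c - 1) * n + (\<phi> - 1)) * (p + 1)" for c \<phi>
  define edge where "edge = (\<lambda>(c, \<phi>, k). (c, luv.trail_edge p (j c) (a c) \<phi> k))"
  define label where "label = (\<lambda>(c, \<phi>, k). zigzag N (base c \<phi> + k))"
  define f where "f = label \<circ> the_inv_into ?D edge"
  have trail: "bij_betw (\<lambda>(\<phi>, k). luv.trail_edge p (j c) (a c) \<phi> k) ({1..n} \<times> {..p})
      (edges (luv_graph p n (j c) (a c)))" if "c \<in> {1..t}" for c
    using that data by (intro luv.bij_betw_trail_edge luv.intro)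
  have inj: "inj_on edge ?D"
  proof (rule inj_onI)
    fix x y assume xy: "x \<in> ?D" "y \<in> ?D" "edge x = edge y"
    obtain c \<phi> k c' \<phi>' k' where x: "x = (c, \<phi>, k)" and y: "y = (c', \<phi>', k')"
      by (metis prod_cases3)
    have D: "c \<in> {1..t}" "\<phi> \<in> {1..n}" "k \<in> {..p}" "c' \<in> {1..t}" "\<phi>' \<in> {1..n}" "k' \<in> {..p}"
      using xy(1,2) by (auto simp: x y)
    have eq: "edge (c, \<phi>, k) = edge (c', \<phi>', k')"
      using xy(3) by (simp only: x y prod.case)
    have "c = c'" using eq by (simp add: edge_def)
    moreover have "(\<phi>, k) = (\<phi>', k')"
      using trail[OF D(1)] D eq \<open>c = c'\<close> unfolding bij_betw_def
      by (elim conjE inj_onD) (auto simp: edge_def)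
    ultimately show "x = y" by (simp add: x y)
  qed
  have "edge ` ?D = (SIGMA c:{1..t}. (\<lambda>(\<phi>, k). luv.trail_edge p (j c) (a c) \<phi> k) ` ({1..n} \<times> {..p}))"
    by (force simp: edge_def)
  also have "\<dots> = edges ?U"
    unfolding luv_union_def disjoint_union_def multigraph.simps
    using trail by (intro Sigma_cong refl) (simp only: bij_betw_def)
  finally have edge: "bij_betw edge ?D (edges ?U)"
    using inj by (simp add: bij_betw_def)
  have "even N" using assms(2) by (simp add: N_def)
  then have "bij_betw label ?D {1..N}"
    using bij_betw_trans[OF bij_betw_mixed_radix[where t = t and n = n and p = p, folded N_def]
        bij_betw_zigzag]
    by (simp add: label_def base_def comp_def case_prod_unfold)
  moreover from this have "card (edges ?U) = N"
    using edge by (metis bij_betw_same_card card_atLeastAtMost diff_Suc_1)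
  ultimately have bij: "bij_betw f (edges ?U) {1..card (edges ?U)}"
    unfolding f_def using bij_betw_trans[OF bij_betw_the_inv_into[OF edge]] by simp
  have f_edge: "f (c, luv.trail_edge p (j c) (a c) \<phi> k) = zigzag N (base c \<phi> + k)"
    if "c \<in> {1..t}" "\<phi> \<in> {1..n}" "k \<le> p" for c \<phi> k
  proof -
    have "f (edge (c, \<phi>, k)) = label (c, \<phi>, k)"
      unfolding f_def comp_def using that by (subst the_inv_into_f_f[OF inj]) auto
    then show ?thesis by (simp add: edge_def label_def)
  qed
  have "vertex_sum ?U f (c, i) = luv_weight t p n (luv_S n (a c)) i"
    if c: "c \<in> {1..t}" and i: "i \<in> {1..p}" for c i
  proof -
    interpret luv p n "j c" "a c" using data c by unfold_locales
    have "even (base c \<phi>) \<and> base c \<phi> + p \<le> N" if "\<phi> \<in> {1..n}" for \<phi>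
    proof -
      have "base c \<phi> + p < N"
        unfolding base_def N_def using c that by (intro mixed_radix_less) auto
      then show ?thesis using assms(2) by (simp add: base_def)
    qed
    then have "vertex_sum (luv_graph p n (j c) (a c)) (\<lambda>e. f (c, e)) i =
        luv_weight t p n (luv_S n (a c)) i"
      unfolding luv_weight_def N_def[symmetric]
      by (intro vertex_sum_zigzag[of i "base c" N]) (use i c f_edge in auto)
    then show ?thesis
      using c by (simp add: luv_union_def vertex_sum_disjoint_union)
  qed
  then show thesis using that bij by blast
qed

section \<open>The merged families\<close>

text \<open>\<open>M c\<close> consists of the vertices of component \<open>c\<close> that are touched by the merging, and
  \<open>K c i\<close> is the block containing \<open>i\<close>.\<close>

lemma chi_la_merged_luv_union:
  assumes "1 \<le> t" and data: "\<And>c. c \<in> {1..t} \<Longrightarrow> luv_data p n (j c) (a c)"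
    and merge: "arises_by_merging (luv_union t p n j a) \<B> G"
    and blocks: "\<And>c i. c \<in> {1..t} \<Longrightarrow> i \<in> {1..p} \<Longrightarrow>
      {y \<in> {1..t} \<times> {1..p}. (c, i) = y \<or> (\<exists>B\<in>\<B>. (c, i) \<in> B \<and> y \<in> B)} = Pair c ` K c i"
    and S_M: "\<And>c. c \<in> {1..t} \<Longrightarrow> luv_S n (a c) \<subseteq> M c"
    and indep: "\<And>c e. c \<in> {1..t} \<Longrightarrow> e \<in> edges (luv_graph p n (j c) (a c)) \<Longrightarrow> \<not> e \<subseteq> M c"
    and K_single: "\<And>c i. c \<in> {1..t} \<Longrightarrow> i \<in> {1..p} \<Longrightarrow> i \<notin> M c \<Longrightarrow> K c i = {i}"
    and K_sum: "\<And>c i. c \<in> {1..t} \<Longrightarrow> i \<in> M c \<Longrightarrow>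
      (\<Sum>y\<in>K c i. luv_weight t p n (luv_S n (a c)) y) = w"
    and w: "n * (t * n * (p + 1) + 1) < w"
  shows "chi_la G = 3"
proof -
  let ?U = "luv_union t p n j a"
  define N where "N = t * n * (p + 1)"
  have 1: "1 \<in> {1..t}" using \<open>1 \<le> t\<close> by simp
  then interpret one: luv p n "j 1" "a 1" using data by unfold_locales
  have verts: "verts ?U = {1..t} \<times> {1..p}"
    by (auto simp: luv_union_def disjoint_union_def luv_graph_def)
  obtain f where f: "bij_betw f (edges ?U) {1..card (edges ?U)}"
    and vsum: "\<And>c i. c \<in> {1..t} \<Longrightarrow> i \<in> {1..p} \<Longrightarrow>
      vertex_sum ?U f (c, i) = luv_weight t p n (luv_S n (a c)) i"
    using luv_union_labeling[of t p n j a] data one.params(1) by blast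
  obtain m where m: "2 * m < p"
    "\<And>i. i < 2 * m \<Longrightarrow> adjacent (luv_graph p n (j 1) (a 1)) (Suc i) (Suc (Suc i))"
    "adjacent (luv_graph p n (j 1) (a 1)) 1 (Suc (2 * m))"
    using one.odd_closed_walk by blast
  have adj: "adjacent ?U (1, x) (1, y)" if "adjacent (luv_graph p n (j 1) (a 1)) x y" for x y
  proof -
    obtain e where "e \<in> edges (luv_graph p n (j 1) (a 1))"
      "ends (luv_graph p n (j 1) (a 1)) e = {x, y}"
      using \<open>adjacent (luv_graph p n (j 1) (a 1)) x y\<close> unfolding adjacent_def by blast
    then show ?thesis
      using 1 unfolding adjacent_def luv_union_def disjoint_union_def
      by (intro bexI[of _ "(1, e)"]) auto
  qed
  \<comment> \<open>Merged vertices share the sum \<open>w\<close>; all other vertices keep a sum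
    determined by their parity.\<close>
  define \<sigma> where "\<sigma> = (\<lambda>(c, i). if i \<in> M c then w else n * (N + i mod 2))"
  show ?thesis
  proof (rule chi_la_merging_eq_3[OF merge _ _ f, where \<sigma> = \<sigma> and z = "\<lambda>i. (1, Suc i)" and m = m])
    show "finite (verts ?U)" by (simp add: verts)
    have "finite (edges (luv_graph p n (j c) (a c)))" if "c \<in> {1..t}" for c
      using luv.bij_betw_trail_edge[OF luv.intro[OF data[OF that]]]
      by (auto dest: bij_betw_finite)
    then show "finite (edges ?U)"
      by (auto simp: luv_union_def disjoint_union_def)
    show "(\<Sum>y | y \<in> verts ?U \<and> (x = y \<or> (\<exists>B\<in>\<B>. x \<in> B \<and> y \<in> B)). vertex_sum ?U f y) = \<sigma> x"
      if xU: "x \<in> verts ?U" for x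
    proof -
      obtain c i where x: "x = (c, i)" "c \<in> {1..t}" "i \<in> {1..p}"
        using xU unfolding verts by blast
      have "Pair c ` K c i \<subseteq> {1..t} \<times> {1..p}"
        using blocks[OF x(2,3)] by blast
      then have K: "K c i \<subseteq> {1..p}" by auto
      have "(\<Sum>y | y \<in> verts ?U \<and> (x = y \<or> (\<exists>B\<in>\<B>. x \<in> B \<and> y \<in> B)). vertex_sum ?U f y) =
          (\<Sum>y\<in>Pair c ` K c i. vertex_sum ?U f y)"
        unfolding verts x(1) blocks[OF x(2,3)] ..
      also have "\<dots> = (\<Sum>y\<in>K c i. luv_weight t p n (luv_S n (a c)) y)"
        using K x(2) vsum by (subst sum.reindex) (auto simp: inj_on_def intro!: sum.cong)
      also have "\<dots> = \<sigma> x"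
        using K_single[OF x(2,3)] K_sum[OF x(2), of i] S_M[OF x(2)]
        by (auto simp: x(1) \<sigma>_def luv_weight_def N_def)
      finally show ?thesis .
    qed
    show "\<exists>x\<in>verts ?U. \<exists>y\<in>verts ?U. ends ?U e = {x, y} \<and> \<sigma> x \<noteq> \<sigma> y" if eU: "e \<in> edges ?U" for e
    proof -
      obtain c d where e: "e = (c, d)" "c \<in> {1..t}" "d \<in> edges (luv_graph p n (j c) (a c))"
        using eU by (auto simp: luv_union_def disjoint_union_def)
      interpret luv p n "j c" "a c" using data e(2) by unfold_locales
      obtain x y where xy: "x \<in> {1..p}" "y \<in> {1..p}" "d = {x, y}"
        "odd x \<noteq> odd y \<or> x \<in> {1, p} \<and> y \<in> luv_S n (a c)"
        using edge_cases[OF e(3)] by blast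
      have "\<not> (x \<in> M c \<and> y \<in> M c)" using indep[OF e(2,3)] xy(3) by simp
      moreover have "n * (N + i mod 2) < w" for i
      proof -
        have "n * (N + i mod 2) \<le> n * (N + 1)" by (intro mult_le_mono2) simp
        then show ?thesis using w by (simp add: N_def)
      qed
      then have "n * (N + i mod 2) \<noteq> w" for i by (metis less_irrefl)
      moreover have "n * (N + x mod 2) \<noteq> n * (N + y mod 2)" if "odd x \<noteq> odd y"
        using that params(3) by (auto simp: mod2_eq_if)
      \<comment> \<open>At most one end lies in \<open>M c\<close>. If one does, \<open>w\<close>
        exceeds the other sum. If none does, the edge avoids \<open>S\<close>, so its ends have
        different parities.\<close>
      ultimately have "\<sigma> (c, x) \<noteq> \<sigma> (c, y)"
        using xy(4) S_M[OF e(2)] by (auto simp: \<sigma>_def)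
      moreover have "ends ?U e = {(c, x), (c, y)}"
        using e xy by (simp add: luv_union_def disjoint_union_def luv_graph_def)
      ultimately show ?thesis using e(2) xy(1,2) by (auto simp: verts)
    qed
    have "\<sigma> ` verts ?U \<subseteq> {w, n * (N + 0), n * (N + 1)}"
      by (auto simp: \<sigma>_def mod2_eq_if)
    then have "card (\<sigma> ` verts ?U) \<le> card {w, n * (N + 0), n * (N + 1)}"
      by (rule card_mono[rotated]) simp
    also have "\<dots> \<le> 3" by (rule card_insert_le_m1) (auto intro: card_insert_le_m1)
    finally show "card (\<sigma> ` verts ?U) \<le> 3" .
    show "(1, Suc i) \<in> verts ?U" if "i \<le> 2 * m" for i
      using that m(1) 1 by (auto simp: verts)
    show "adjacent ?U (1, Suc i) (1, Suc (Suc i))" if "i < 2 * m" for i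
      using adj m(2) that by blast
    show "adjacent ?U (1, Suc 0) (1, Suc (2 * m))"
      using adj m(3) by simp
  qed
qed

text \<open>Handles partners in \<open>O\<close> (\<open>r = 1\<close>) and in \<open>Q\<close>
  (\<open>r = 0\<close>) together. All partners have the same parity and lie outside
  \<open>S\<close>, so every block consists of one vertex of each kind and all blocks have the same
  total.\<close>

lemma chi_la_matched_luv_union:
  assumes "1 \<le> t" and data: "\<And>c. c \<in> {1..t} \<Longrightarrow> luv_data p n (j c) (a c)"
    and matching: "\<And>c. c \<in> {1..t} \<Longrightarrow> luv_matching p n (j c) (a c) (C c) (v c)"
    and C: "\<And>c. c \<in> {1..t} \<Longrightarrow> C c \<subseteq> {i \<in> {1..p}. i mod 2 = r} - luv_S n (a c)"
    and merge: "arises_by_merging (luv_union t p n j a)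
      {{(c, s), (c, v c s)} | c s. c \<in> {1..t} \<and> s \<in> luv_S n (a c)} G"
  shows "chi_la G = 3"
proof -
  define N where "N = t * n * (p + 1)"
  define S where "S c = luv_S n (a c)" for c
  have v_inj: "inj_on (v c) (S c)" and v_C: "v c ` S c \<subseteq> {i \<in> {1..p}. i mod 2 = r} - S c"
    if "c \<in> {1..t}" for c
    using matching[OF that] C[OF that] by (auto simp: luv_matching_def S_def)
  have S_range: "S c \<subseteq> {i. odd i \<and> 1 < i \<and> i < p}" if "c \<in> {1..t}" for c
    unfolding S_def using luv.luv_S_range[OF luv.intro[OF data[OF that]]] .
  \<comment> \<open>Blocks are disjoint, because \<open>v c\<close> is injective on
    \<open>S c\<close> and its values avoid \<open>S c\<close>; hence a vertex determines its
    block.\<close>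
  have pair: "{y. i = y \<or> (\<exists>s\<in>S c. i \<in> {s, v c s} \<and> y \<in> {s, v c s})} = {s, v c s}"
    if "c \<in> {1..t}" "s \<in> S c" "i \<in> {s, v c s}" for c s i
  proof -
    have unique: "s' = s" if "s' \<in> S c" "i \<in> {s', v c s'}" for s'
      using that \<open>s \<in> S c\<close> \<open>i \<in> {s, v c s}\<close> v_inj[OF \<open>c \<in> {1..t}\<close>] v_C[OF \<open>c \<in> {1..t}\<close>]
      by (auto dest: inj_onD)
    show ?thesis
    proof (intro set_eqI iffI)
      fix y assume "y \<in> {y. i = y \<or> (\<exists>s\<in>S c. i \<in> {s, v c s} \<and> y \<in> {s, v c s})}"
      then consider "y = i" | s' where "s' \<in> S c" "i \<in> {s', v c s'}" "y \<in> {s', v c s'}"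
        by blast
      then show "y \<in> {s, v c s}"
        by cases (use unique that(3) in auto)
    qed (use that(2,3) in blast)
  qed
  let ?K = "\<lambda>c i. {y. i = y \<or> (\<exists>s\<in>S c. i \<in> {s, v c s} \<and> y \<in> {s, v c s})}"
  let ?w = "n * (N + 1) + (N + (p + 1) div 2) + n * (N + r)"
  show ?thesis
  proof (rule chi_la_merged_luv_union[OF \<open>1 \<le> t\<close> data merge,
        where K = ?K and M = "\<lambda>c. S c \<union> v c ` S c" and w = ?w])
    show "{y \<in> {1..t} \<times> {1..p}. (c, i) = y \<or> (\<exists>B\<in>{{(c, s), (c, v c s)} | c s.
        c \<in> {1..t} \<and> s \<in> luv_S n (a c)}. (c, i) \<in> B \<and> y \<in> B)} = Pair c ` ?K c i"
      (is "?L = ?R") if c: "c \<in> {1..t}" and i: "i \<in> {1..p}" for c i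
    proof
      show "?L \<subseteq> ?R" by (auto simp: S_def)
      have "?K c i \<subseteq> {1..p}"
      proof -
        have "S c \<subseteq> {1..p}" "v c ` S c \<subseteq> {1..p}"
          using v_C[OF c] S_range[OF c] by auto
        then show ?thesis using i by blast
      qed
      show "?R \<subseteq> ?L"
      proof (rule image_subsetI)
        fix y assume y: "y \<in> ?K c i"
        then consider "i = y" | s where "s \<in> S c" "i \<in> {s, v c s}" "y \<in> {s, v c s}" by blast
        then have "(c, i) = (c, y) \<or> (\<exists>B\<in>{{(c, s), (c, v c s)} | c s.
            c \<in> {1..t} \<and> s \<in> luv_S n (a c)}. (c, i) \<in> B \<and> (c, y) \<in> B)"
        proof cases
          case (2 s)
          then have "{(c, s), (c, v c s)} \<in> {{(c, s), (c, v c s)} | c s.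
              c \<in> {1..t} \<and> s \<in> luv_S n (a c)}"
            using c unfolding S_def by blast
          moreover have "(c, i) \<in> {(c, s), (c, v c s)}" "(c, y) \<in> {(c, s), (c, v c s)}"
            using 2 by auto
          ultimately show ?thesis by blast
        qed simp
        moreover have "y \<in> {1..p}" using \<open>?K c i \<subseteq> {1..p}\<close> y by blast
        ultimately show "(c, y) \<in> ?L" using c by blast
      qed
    qed
    show "luv_S n (a c) \<subseteq> S c \<union> v c ` S c" for c by (simp add: S_def)
    show "\<not> e \<subseteq> S c \<union> v c ` S c"
      if c: "c \<in> {1..t}" and e: "e \<in> edges (luv_graph p n (j c) (a c))" for c e
    proof
      assume sub: "e \<subseteq> S c \<union> v c ` S c"
      interpret luv p n "j c" "a c" using data c by unfold_locales
      obtain x y where xy: "e = {x, y}" "odd x \<noteq> odd y \<or> x \<in> {1, p} \<and> y \<in> S c"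
        using edge_cases[OF e] unfolding S_def by blast
      have adj: "adjacent (luv_graph p n (j c) (a c)) x y"
        unfolding adjacent_def using e xy(1)
        by (intro bexI[of _ e]) (simp_all add: luv_graph_def)
      then have adj': "adjacent (luv_graph p n (j c) (a c)) y x"
        by (simp add: adjacent_def insert_commute)
      have "\<not> (x \<in> v c ` S c \<and> y \<in> S c)" "\<not> (y \<in> v c ` S c \<and> x \<in> S c)"
        using matching[OF c] adj adj' unfolding luv_matching_def S_def by blast+
      moreover have "\<not> (x \<in> S c \<and> y \<in> S c)" using xy(2) S_range[OF c] by auto
      \<comment> \<open>An edge needs ends of opposite parity or an end in \<open>S\<close>; two
        partners offer neither.\<close>
      moreover have "\<not> (x \<in> v c ` S c \<and> y \<in> v c ` S c)"
      proof
        assume "x \<in> v c ` S c \<and> y \<in> v c ` S c"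
        then have "x mod 2 = r" "y mod 2 = r" "y \<notin> S c" using v_C[OF c] by auto
        then show False using xy(2) by presburger
      qed
      ultimately show False using sub xy(1) by auto
    qed
    show "?K c i = {i}" if "i \<notin> S c \<union> v c ` S c" for c i
      using that by auto
    show "(\<Sum>y\<in>?K c i. luv_weight t p n (luv_S n (a c)) y) = ?w"
      if c: "c \<in> {1..t}" and i: "i \<in> S c \<union> v c ` S c" for c i
    proof -
      obtain s where s: "s \<in> S c" "i \<in> {s, v c s}" using i by auto
      have "v c s mod 2 = r" "v c s \<notin> S c" "s mod 2 = 1"
        using v_C[OF c] S_range[OF c] s(1) by (auto simp: mod2_eq_if)
      moreover have "s \<noteq> v c s" using calculation s(1) by auto
      ultimately show ?thesis
        unfolding pair[OF c s] luv_weight_def S_def[symmetric] N_def[symmetric]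
        using s(1) by simp
    qed
    have "1 \<in> {1..t}" using \<open>1 \<le> t\<close> by simp
    \<comment> \<open>Positivity of \<open>(p + 1) div 2\<close> makes the next inequality
      strict.\<close>
    then have "9 \<le> p" using luv.params(2) luv.intro data by blast
    then show "n * (t * n * (p + 1) + 1) < ?w"
      unfolding N_def[symmetric] by (intro trans_less_add1[of _ "_ + (_ + _)"]) simp
  qed
qed

text \<open>The single block of a component has \<open>n\<close> vertices of equal weight. It is
  independent, since an edge of \<open>F\<close> has its other end at 1 or \<open>p\<close>, outside
  \<open>S\<close>.\<close>

lemma chi_la_contracted_luv_union:
  assumes "1 \<le> t" and data: "\<And>c. c \<in> {1..t} \<Longrightarrow> luv_data p n (j c) (a c)"
    and merge: "arises_by_merging (luv_union t p n j a)
      {{c} \<times> luv_S n (a c) | c. c \<in> {1..t}} G"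
  shows "chi_la G = 3"
proof -
  define N where "N = t * n * (p + 1)"
  define S where "S c = luv_S n (a c)" for c
  have S_range: "S c \<subseteq> {i. odd i \<and> 1 < i \<and> i < p}" and card_S: "card (S c) = n"
    if "c \<in> {1..t}" for c
    unfolding S_def using luv.luv_S_range luv.card_luv_S luv.intro data that by blast+
  let ?K = "\<lambda>c i. if i \<in> S c then S c else {i}"
  let ?w = "n * (n * (N + 1) + (N + (p + 1) div 2))"
  show ?thesis
  proof (rule chi_la_merged_luv_union[OF \<open>1 \<le> t\<close> data merge, where K = ?K and M = S and w = ?w])
    show "{y \<in> {1..t} \<times> {1..p}. (c, i) = y \<or> (\<exists>B\<in>{{c} \<times> luv_S n (a c) | c. c \<in> {1..t}}.
        (c, i) \<in> B \<and> y \<in> B)} = Pair c ` ?K c i"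
      (is "?L = ?R") if c: "c \<in> {1..t}" and i: "i \<in> {1..p}" for c i
    proof
      show "?L \<subseteq> ?R" by (auto simp: S_def)
      have "?K c i \<subseteq> {1..p}" using i S_range[OF c] by auto
      then show "?R \<subseteq> ?L" using c by (auto simp: S_def split: if_splits)
    qed
    show "luv_S n (a c) \<subseteq> S c" for c by (simp add: S_def)
    show "\<not> e \<subseteq> S c"
      if c: "c \<in> {1..t}" and e: "e \<in> edges (luv_graph p n (j c) (a c))" for c e
    proof
      assume "e \<subseteq> S c"
      obtain x y where xy: "e = {x, y}" "odd x \<noteq> odd y \<or> x \<in> {1, p} \<and> y \<in> luv_S n (a c)"
        using luv.edge_cases[OF luv.intro[OF data[OF c]] e] by metis
      have "x \<in> {i. odd i \<and> 1 < i \<and> i < p}" "y \<in> {i. odd i \<and> 1 < i \<and> i < p}"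
        using \<open>e \<subseteq> S c\<close> xy(1) S_range[OF c] by blast+
      then show False using xy(2) by simp
    qed
    show "?K c i = {i}" if "i \<notin> S c" for c i
      using that by simp
    show "(\<Sum>y\<in>?K c i. luv_weight t p n (luv_S n (a c)) y) = ?w"
      if c: "c \<in> {1..t}" and "i \<in> S c" for c i
    proof -
      have "(\<Sum>y\<in>S c. luv_weight t p n (luv_S n (a c)) y) =
          (\<Sum>y\<in>S c. n * (N + 1) + (N + (p + 1) div 2))"
      proof (rule sum.cong[OF refl])
        fix y assume y: "y \<in> S c"
        then have "y mod 2 = 1" using S_range[OF c] by (auto simp: mod2_eq_if)
        with y show "luv_weight t p n (luv_S n (a c)) y = n * (N + 1) + (N + (p + 1) div 2)"
          unfolding luv_weight_def S_def[symmetric] N_def[symmetric] by simp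
      qed
      then show ?thesis using that card_S[OF c] by simp
    qed
    have "1 \<in> {1..t}" using \<open>1 \<le> t\<close> by simp
    then have n: "2 \<le> n" using luv.params(3) luv.intro data by blast
    \<comment> \<open>Already the multiple \<open>n * (n * (N + 1))\<close> exceeds
      \<open>n * (N + 1)\<close>, because \<open>n\<close> is at least 2.\<close>
    then have "n * (N + 1) < n * (n * (N + 1)) + n * (N + (p + 1) div 2)"
    proof -
      have "2 * (n * (N + 1)) \<le> n * (n * (N + 1))" using n by (intro mult_le_mono1)
      moreover have "0 < n * (N + 1)" using n by simp
      ultimately show ?thesis by linarith
    qed
    then show "n * (t * n * (p + 1) + 1) < ?w"
      unfolding N_def[symmetric] by (simp only: add_mult_distrib2)
  qed
qed

theorem theorem2p5:
  fixes t n p :: nat and G :: "('v, 'e) multigraph"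
  assumes "t \<ge> 1" and "n \<ge> 2" and "p \<ge> 9" and "odd p"
    and "G \<in> GL4 t (p - n) n \<union> GL5 t (p - n) n \<union> GL6 t (p - n + 1) n"
  shows "chi_la G = 3"
proof -
  consider "G \<in> GL4 t (p - n) n" | "G \<in> GL5 t (p - n) n" | "G \<in> GL6 t (p - n + 1) n"
    using assms(5) by blast
  then show ?thesis
  proof cases
    case 1
    then obtain q j a v where "\<And>c. c \<in> {1..t} \<Longrightarrow> luv_data q n (j c) (a c)"
      "\<And>c. c \<in> {1..t} \<Longrightarrow> luv_matching q n (j c) (a c) (luv_O q n (a c)) (v c)"
      "arises_by_merging (luv_union t q n j a)
        {{(c, s), (c, v c s)} | c s. c \<in> {1..t} \<and> s \<in> luv_S n (a c)} G"
      unfolding GL4_def by blast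
    moreover have "luv_O q n b \<subseteq> {i \<in> {1..q}. i mod 2 = 1} - luv_S n b" for b
      by (auto simp: luv_O_def mod2_eq_if)
    ultimately show ?thesis
      by (intro chi_la_matched_luv_union[OF \<open>t \<ge> 1\<close>, where r = 1])
  next
    case 2
    then obtain q j a v where data: "\<And>c. c \<in> {1..t} \<Longrightarrow> luv_data q n (j c) (a c)"
      and rest: "\<And>c. c \<in> {1..t} \<Longrightarrow> luv_matching q n (j c) (a c) (luv_Q q) (v c)"
      "arises_by_merging (luv_union t q n j a)
        {{(c, s), (c, v c s)} | c s. c \<in> {1..t} \<and> s \<in> luv_S n (a c)} G"
      unfolding GL5_def by blast
    have "luv_Q q \<subseteq> {i \<in> {1..q}. i mod 2 = 0} - luv_S n b" for b
      by (auto simp: luv_Q_def luv_S_def)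
    with data rest show ?thesis
      by (intro chi_la_matched_luv_union[OF \<open>t \<ge> 1\<close>, where r = 0])
  next
    case 3
    then obtain q j a where "\<And>c. c \<in> {1..t} \<Longrightarrow> luv_data q n (j c) (a c)"
      "arises_by_merging (luv_union t q n j a) {{c} \<times> luv_S n (a c) | c. c \<in> {1..t}} G"
      unfolding GL6_def by blast
    then show ?thesis
      by (intro chi_la_contracted_luv_union[OF \<open>t \<ge> 1\<close>])
  qed
qed

end
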